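(* Let $\{x_k\}_{k\ge 0}$ be generated by the Damped Quartic Newton Method (described in the context) applied to the problem $F^*=\min_{x\in\mathrm{dom}\,\psi}[F(x)=f(x)+\psi(x)]$, where $f$ is a convex quartic polynomial with positive definite quartic form $f_4$ and $\psi$ is a closed convex function. Then for all $k\ge 0$ we have $$F(x_k)-F^*\le(1-\alpha_* )^k\,(F(x_0)-F^* ),$$ where $\alpha_*=\frac{3\tau_*-1}{3\tau_*+1}>0.193$ with $\tau_*=\frac16\sqrt{3+\sqrt{33}}$.
   Context: $\mathbb{E}$ is a finite-dimensional real vector space with dual pairing $\langle\cdot,\cdot\rangle$. $f:\mathbb{E}\to\mathbb{R}$ is a convex polynomial of degree four; $f_4=\frac1{24}D^4f$ is the associated (constant) symmetric $4$-linear form, with $f_4[x]^4=f_4[x,x,x,x]$. It is assumed that $f_4$ is positive definite, i.e. $f_4[x]^4>0$ for all $x\in\mathbb{E}\setminus\{0\}$, and the norm $\|x\|_f=(f_4[x]^4)^{1/4}$ is used. $\psi$ is a closed convex function with nonempty domain $\mathrm{dom}\,\psi\subseteq\mathbb{E}$. For $\tau>0$, $x,y\in\mathbb{E}$ put $$\hat f_{x,\tau}(y)=f(x)+\langle\nabla f(x),y-x\rangle+\frac{1+3\tau}{6\tau}\langle\nabla^2f(x)(y-x),y-x\rangle+(1+2\tau)\|y-x\|_f^4 .$$ The number $\tau_*$ is the unique positive root of the equation $\frac{3\tau-1}{3\tau+1}=\left[\frac{1-2\tau}{1+2\tau}\right]^{1/3}$. Damped Quartic Newton Method: choose $x_0\in\mathrm{dom}\,\psi$;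 for $k\ge0$ set $x_{k+1}=\arg\min_{y\in\mathrm{dom}\,\psi}[\hat f_{x_k,\tau_*}(y)+\psi(y)]$. *)

theory Defs
  imports "HOL-Analysis.Analysis"
begin

text \<open>Polynomial functions of total degree at most \<open>n\<close>, in the coordinates given by the basis;
  \<open>m\<close> ranges over multi-indices. Total degree does not depend on the choice of basis.\<close>

definition poly_fun_le :: "nat \<Rightarrow> ('a::euclidean_space \<Rightarrow> real) \<Rightarrow> bool" where
  "poly_fun_le n f \<longleftrightarrow>
     (\<exists>c. \<forall>x. f x = (\<Sum>m | m \<in> Basis \<rightarrow>\<^sub>E {..n} \<and> (\<Sum>b\<in>Basis. m b) \<le> n.
                       c m * (\<Prod>b\<in>Basis. (x \<bullet> b) ^ m b)))"

definition poly_fun_of_degree :: "nat \<Rightarrow> ('a::euclidean_space \<Rightarrow> real) \<Rightarrow> bool" where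
  "poly_fun_of_degree n f \<longleftrightarrow> poly_fun_le n f \<and> (\<forall>m<n. \<not> poly_fun_le m f)"

text \<open>\<open>Dn f [h\<^sub>1, \<dots>, h\<^sub>p] x\<close> is the derivative \<open>D\<^sup>p f(x)[h\<^sub>1, \<dots>, h\<^sub>p]\<close>. In particular
  \<open>Dn f [h] x\<close> is the dual pairing of the gradient at \<open>x\<close> with \<open>h\<close>, and \<open>Dn f [h, h] x\<close> is
  the pairing of the Hessian at \<open>x\<close> applied to \<open>h\<close> with \<open>h\<close>; no inner product is involved.\<close>

fun Dn :: "('a::real_normed_vector \<Rightarrow> real) \<Rightarrow> 'a list \<Rightarrow> 'a \<Rightarrow> real" where
  "Dn f [] x = f x"
| "Dn f (h # hs) x = frechet_derivative (Dn f hs) (at x) h"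

text \<open>For a polynomial of degree four the fourth derivative does not depend on the point, so
  evaluating it at the origin is no restriction.\<close>

definition quartic_form :: "('a::real_normed_vector \<Rightarrow> real) \<Rightarrow> 'a \<Rightarrow> 'a \<Rightarrow> 'a \<Rightarrow> 'a \<Rightarrow> real" where
  "quartic_form f h1 h2 h3 h4 = (1/24) * Dn f [h1, h2, h3, h4] 0"

definition fnorm :: "('a::real_normed_vector \<Rightarrow> real) \<Rightarrow> 'a \<Rightarrow> real" where
  "fnorm f h = root 4 (quartic_form f h h h h)"

definition fhat :: "('a::real_normed_vector \<Rightarrow> real) \<Rightarrow> 'a \<Rightarrow> real \<Rightarrow> 'a \<Rightarrow> real" where
  "fhat f x \<tau> y = f x + Dn f [y - x] x
     + (1 + 3 * \<tau>) / (6 * \<tau>) * Dn f [y - x, y - x] x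
     + (1 + 2 * \<tau>) * fnorm f (y - x) ^ 4"

text \<open>\<open>root 3\<close> is the odd real cube root, so the equation is meaningful also for \<open>\<tau> > 1/2\<close>.\<close>

definition tau_star :: real where
  "tau_star = (THE \<tau>. \<tau> > 0 \<and>
     (3 * \<tau> - 1) / (3 * \<tau> + 1) = root 3 ((1 - 2 * \<tau>) / (1 + 2 * \<tau>)))"

definition alpha_star :: real where
  "alpha_star = (3 * tau_star - 1) / (3 * tau_star + 1)"

text \<open>A function \<open>\<psi>\<close> with effective domain \<open>D\<close> is given by its real values on \<open>D\<close>; the values
  outside \<open>D\<close> are irrelevant. It is closed if its epigraph over \<open>D\<close> is closed
  (\<open>D\<close> itself need not be closed).\<close>

definition closed_convex_fun :: "'a::euclidean_space set \<Rightarrow> ('a \<Rightarrow> real) \<Rightarrow> bool" where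
  "closed_convex_fun D \<psi> \<longleftrightarrow> D \<noteq> {} \<and> convex_on D \<psi> \<and> closed (epigraph D \<psi>)"

definition damped_quartic_newton ::
  "('a::euclidean_space \<Rightarrow> real) \<Rightarrow> 'a set \<Rightarrow> ('a \<Rightarrow> real) \<Rightarrow> (nat \<Rightarrow> 'a) \<Rightarrow> bool" where
  "damped_quartic_newton f D \<psi> x \<longleftrightarrow> x 0 \<in> D \<and>
     (\<forall>k. is_arg_min (\<lambda>y. fhat f (x k) tau_star y + \<psi> y) (\<lambda>y. y \<in> D) (x (Suc k)))"

definition min_value :: "('a \<Rightarrow> real) \<Rightarrow> 'a set \<Rightarrow> real" where
  "min_value F D = (LEAST v. v \<in> F ` D)"

end

theory Submission
  imports Defs
begin

text \<open>The proof sandwiches \<open>f\<close> between two quartic models. Along every line a convex quartic has a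
  nonnegative second derivative, and this second derivative is a quadratic in the step length
  whose linear coefficient is the third derivative of \<open>f\<close>. Evaluating it at the steps \<open>\<tau>\<close> and
  \<open>-\<tau>\<close> bounds the third derivative by the second and fourth ones
  (\<open>convex_quartic_third_derivative_bound\<close>). Inserting the bound into the exact Taylor expansion
  gives an upper and a lower model of \<open>f\<close>; the upper one is \<open>fhat\<close>.

  If the step from \<open>x\<close> towards any \<open>y\<close> in the domain is damped by the factor
  \<open>alpha_star\<close>, the second and fourth order terms of the upper model shrink exactly to
  \<open>alpha_star\<close> times those of the lower model for the full step; \<open>tau_star\<close> is the parameter for
  which both coincidences happen for the same factor (\<open>fhat_damped_point\<close>). As the lower
  model lies below \<open>f\<close>, an iteration satisfies
  \<open>F x' \<le> (1 - alpha_star) * F x + alpha_star * F y\<close> for every \<open>y\<close> in the domain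
  (\<open>damped_newton_step\<close>), and with a minimizer for \<open>y\<close> this is linear convergence.

  It remains to see that a minimizer exists, since otherwise the minimal value would not be
  attained and \<open>min_value\<close> would be arbitrary. Positive definiteness makes \<open>f\<close> grow like the
  fourth power of the norm, whereas \<open>\<psi>\<close> has an affine minorant; so sublevel sets are bounded
  and compactness applies to a truncated epigraph (\<open>composite_attains_minimum\<close>).\<close>

section \<open>Polynomial functions and their Taylor expansion\<close>

text \<open>A coordinate-free form of \<open>poly_fun_le\<close>: an upper bound on the degree is carried along the
  construction of the function. Differentiation lowers this bound by one, which is how a fifth
  derivative of a quartic is seen to vanish.\<close>
inductive poly_deg :: "nat \<Rightarrow> ('a::real_normed_vector \<Rightarrow> real) \<Rightarrow> bool" where
  poly_deg_const: "poly_deg n (\<lambda>_. c)"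
| poly_deg_linear: "bounded_linear f \<Longrightarrow> poly_deg 1 f"
| poly_deg_add: "poly_deg n f \<Longrightarrow> poly_deg n g \<Longrightarrow> poly_deg n (\<lambda>x. f x + g x)"
| poly_deg_mult: "poly_deg m f \<Longrightarrow> poly_deg n g \<Longrightarrow> poly_deg (m + n) (\<lambda>x. f x * g x)"

lemma poly_deg_mono:
  assumes "poly_deg m f" "m \<le> n"
  shows "poly_deg n f"
  using poly_deg_mult[OF assms(1) poly_deg_const[of "n - m" 1]] assms(2) by simp

lemma poly_deg_sum:
  assumes "\<And>i. i \<in> I \<Longrightarrow> poly_deg n (g i)"
  shows "poly_deg n (\<lambda>x. \<Sum>i\<in>I. g i x)"
  using assms
  by (induction I rule: infinite_finite_induct) (auto intro: poly_deg_const poly_deg_add)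

lemma poly_deg_power:
  assumes "poly_deg n f"
  shows "poly_deg (k * n) (\<lambda>x. f x ^ k)"
  by (induction k) (auto intro: poly_deg_const poly_deg_mult assms)

lemma poly_deg_prod:
  assumes "\<And>i. i \<in> I \<Longrightarrow> poly_deg (d i) (g i)"
  shows "poly_deg (\<Sum>i\<in>I. d i) (\<lambda>x. \<Prod>i\<in>I. g i x)"
  using assms
  by (induction I rule: infinite_finite_induct) (auto intro: poly_deg_const poly_deg_mult)

lemma poly_fun_le_imp_poly_deg:
  assumes "poly_fun_le n f"
  shows "poly_deg n f"
proof -
  obtain c where c: "f = (\<lambda>x. \<Sum>m | m \<in> Basis \<rightarrow>\<^sub>E {..n} \<and> (\<Sum>b\<in>Basis. m b) \<le> n.
                       c m * (\<Prod>b\<in>Basis. (x \<bullet> b) ^ m b))"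
    using assms unfolding poly_fun_le_def by blast
  have monomial: "poly_deg (\<Sum>b\<in>Basis. m b) (\<lambda>x::'a. \<Prod>b\<in>Basis. (x \<bullet> b) ^ m b)" for m
    using poly_deg_power[OF poly_deg_linear[OF bounded_linear_inner_left]]
    by (intro poly_deg_prod) force
  show ?thesis
    unfolding c
    using poly_deg_mult[OF poly_deg_const[of 0] poly_deg_mono[OF monomial]]
    by (intro poly_deg_sum) auto
qed

lemma poly_deg_0_const:
  assumes "poly_deg 0 f"
  shows "f x = f y"
proof -
  have "n = 0 \<Longrightarrow> f x = f y" if "poly_deg n f" for n
    using that by (induction rule: poly_deg.induct) auto
  with assms show ?thesis by blast
qed

lemma poly_deg_differentiable:
  assumes "poly_deg n f"
  shows "f differentiable (at x)"
  using assms
  by (induction rule: poly_deg.induct)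
     (auto intro: differentiable_add differentiable_mult bounded_linear_imp_differentiable)

lemma poly_deg_continuous:
  assumes "poly_deg n f"
  shows "continuous_on S f"
  using poly_deg_differentiable[OF assms]
  by (meson continuous_at_imp_continuous_on differentiable_imp_continuous_within)

text \<open>The product rule keeps the bound only if a factor of degree bound \<open>0\<close> is treated separately:
  there the truncated \<open>0 - 1\<close> does not decrease, but such a factor is constant and its
  derivative is zero.\<close>
lemma poly_deg_frechet_derivative:
  assumes "poly_deg n f"
  shows "poly_deg (n - 1) (\<lambda>x. frechet_derivative f (at x) h)"
  using assms
proof (induction rule: poly_deg.induct)
  case (poly_deg_const n c)
  then show ?case by (simp add: poly_deg.poly_deg_const)
next
  case (poly_deg_linear f)
  then have "frechet_derivative f (at x) = f" for x
    by (metis bounded_linear_imp_has_derivative frechet_derivative_at)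
  then show ?case by (simp add: poly_deg.poly_deg_const)
next
  case (poly_deg_add n f g)
  note diff = poly_deg_differentiable[OF poly_deg_add.hyps(1)]
    poly_deg_differentiable[OF poly_deg_add.hyps(2)]
  have "frechet_derivative (\<lambda>x. f x + g x) (at x) h
      = frechet_derivative f (at x) h + frechet_derivative g (at x) h" for x
    using has_derivative_add[OF diff(1)[unfolded frechet_derivative_works]
        diff(2)[unfolded frechet_derivative_works], THEN frechet_derivative_at, symmetric]
    by simp
  then show ?case using poly_deg_add.IH by (simp add: poly_deg.poly_deg_add)
next
  case (poly_deg_mult m f n g)
  note diff = poly_deg_differentiable[OF poly_deg_mult.hyps(1)]
    poly_deg_differentiable[OF poly_deg_mult.hyps(2)]
  have product_rule: "frechet_derivative (\<lambda>x. f x * g x) (at x) h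
      = f x * frechet_derivative g (at x) h + frechet_derivative f (at x) h * g x" for x
    using has_derivative_mult[OF diff(1)[unfolded frechet_derivative_works]
        diff(2)[unfolded frechet_derivative_works], THEN frechet_derivative_at, symmetric]
    by simp
  have left: "poly_deg (m + n - 1) (\<lambda>x. f x * frechet_derivative g (at x) h)"
  proof (cases "n = 0")
    case True
    have "g = (\<lambda>_. g 0)" using poly_deg_0_const poly_deg_mult.hyps(2) True by blast
    then have "frechet_derivative g (at x) h = 0" for x
      by (metis frechet_derivative_const)
    then show ?thesis by (simp add: poly_deg.poly_deg_const)
  next
    case False
    then show ?thesis
      using poly_deg.poly_deg_mult[OF poly_deg_mult.hyps(1) poly_deg_mult.IH(2)] by simp
  qed
  have right: "poly_deg (m + n - 1) (\<lambda>x. frechet_derivative f (at x) h * g x)"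
  proof (cases "m = 0")
    case True
    have "f = (\<lambda>_. f 0)" using poly_deg_0_const poly_deg_mult.hyps(1) True by blast
    then have "frechet_derivative f (at x) h = 0" for x
      by (metis frechet_derivative_const)
    then show ?thesis by (simp add: poly_deg.poly_deg_const)
  next
    case False
    then show ?thesis
      using poly_deg.poly_deg_mult[OF poly_deg_mult.IH(1) poly_deg_mult.hyps(2)] by simp
  qed
  show ?case unfolding product_rule by (rule poly_deg_add[OF left right])
qed

lemma poly_deg_Dn:
  assumes "poly_deg n f"
  shows "poly_deg (n - length hs) (Dn f hs)"
proof (induction hs)
  case Nil
  have "Dn f [] = f" by auto
  with assms show ?case by simp
next
  case (Cons h hs)
  have "Dn f (h # hs) = (\<lambda>x. frechet_derivative (Dn f hs) (at x) h)" by auto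
  then show ?case using poly_deg_frechet_derivative[OF Cons, of h] by simp
qed

lemma Dn_append: "Dn f (hs @ gs) x = Dn (Dn f gs) hs x"
proof (induction hs arbitrary: x)
  case (Cons h hs)
  have "Dn f (hs @ gs) = Dn (Dn f gs) hs" using Cons by blast
  then show ?case by simp
qed simp

lemma Dn_scale:
  assumes "poly_deg n f"
  shows "Dn f (map (\<lambda>h. c *\<^sub>R h) hs) x = c ^ length hs * Dn f hs x"
proof (induction hs arbitrary: x)
  case (Cons h hs)
  let ?g = "Dn f hs"
  have diff: "?g differentiable (at x)"
    using poly_deg_Dn[OF assms] poly_deg_differentiable by blast
  have "Dn f (map (\<lambda>h. c *\<^sub>R h) hs) = (\<lambda>x. c ^ length hs * ?g x)"
    using Cons by blast
  moreover have "frechet_derivative (\<lambda>x. c ^ length hs * ?g x) (at x)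
      = (\<lambda>v. c ^ length hs * frechet_derivative ?g (at x) v)"
    using has_derivative_mult_right[OF diff[unfolded frechet_derivative_works]]
      frechet_derivative_at by metis
  moreover have "frechet_derivative ?g (at x) (c *\<^sub>R h) = c * frechet_derivative ?g (at x) h"
    using linear_frechet_derivative[OF diff] by (simp add: linear_scale)
  ultimately show ?case by simp
qed simp

lemma Dn_replicate_scale:
  assumes "poly_deg n f"
  shows "Dn f (replicate k (c *\<^sub>R h)) x = c ^ k * Dn f (replicate k h) x"
  using Dn_scale[OF assms, of c "replicate k h"] by simp

text \<open>Along the line through \<open>x\<close> in direction \<open>h\<close> the \<open>k\<close>-th derivative is
  \<open>Dn f (replicate k h)\<close>. The \<open>n\<close>-th one has degree bound \<open>0\<close>, so it is constant and the
  Lagrange remainder of the next order is zero.\<close>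
lemma poly_deg_taylor:
  assumes "poly_deg n f"
  shows "f (x + h) = (\<Sum>k\<le>n. Dn f (replicate k h) x / fact k)"
proof -
  define p where "p k t = Dn f (replicate k h) (x + t *\<^sub>R h)" for k t
  have "(p k has_real_derivative p (Suc k) t) (at t)" for k t
  proof -
    let ?g = "Dn f (replicate k h)"
    have diff: "?g differentiable (at (x + t *\<^sub>R h))"
      using poly_deg_Dn[OF assms] poly_deg_differentiable by blast
    have line: "((\<lambda>t. x + t *\<^sub>R h) has_derivative (\<lambda>s. s *\<^sub>R h)) (at t)"
      by (auto intro!: derivative_eq_intros)
    have "(p k has_derivative (\<lambda>s. frechet_derivative ?g (at (x + t *\<^sub>R h)) (s *\<^sub>R h))) (at t)"
      unfolding p_def
      using has_derivative_compose[OF line diff[unfolded frechet_derivative_works]] by simp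
    then show ?thesis
      using linear_frechet_derivative[OF diff]
      by (simp add: has_field_derivative_def p_def linear_scale mult_commute_abs)
  qed
  then obtain t where t: "p 0 1 = (\<Sum>k<Suc n. p k 0 / fact k * 1 ^ k) + p (Suc n) t / fact (Suc n) * 1 ^ Suc n"
    using Maclaurin_all_le[of p "p 0" 1 "Suc n"] by metis
  have "Dn f (replicate n h) = (\<lambda>_. Dn f (replicate n h) 0)"
    using poly_deg_0_const poly_deg_Dn[OF assms, of "replicate n h"] by fastforce
  then have "p (Suc n) t = 0"
    unfolding p_def by (metis Dn.simps(2) frechet_derivative_const replicate_Suc)
  with t show ?thesis by (simp add: p_def lessThan_Suc_atMost)
qed

text \<open>The fourth derivative is constant, so its value at the origin, which defines
  \<open>quartic_form\<close>, is its value at every point.\<close>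
lemma quartic_form_eq_Dn:
  assumes "poly_deg 4 f"
  shows "Dn f [h, h, h, h] x = 24 * quartic_form f h h h h"
  using poly_deg_0_const poly_deg_Dn[OF assms, of "[h, h, h, h]"]
  by (fastforce simp: quartic_form_def)

lemma quartic_taylor:
  assumes "poly_deg 4 f"
  shows "f (x + t *\<^sub>R h) = f x + t * Dn f [h] x + t^2 / 2 * Dn f [h, h] x
           + t^3 / 6 * Dn f [h, h, h] x + t^4 * quartic_form f h h h h"
  unfolding poly_deg_taylor[OF assms] Dn_replicate_scale[OF assms]
  using quartic_form_eq_Dn[OF assms, of h x]
  by (simp add: numeral_eq_Suc)

lemma quartic_hessian_taylor:
  assumes "poly_deg 4 f"
  shows "Dn f [h, h] (x + t *\<^sub>R h)
           = Dn f [h, h] x + t * Dn f [h, h, h] x + 12 * t^2 * quartic_form f h h h h"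
proof -
  have deg: "poly_deg 2 (Dn f [h, h])" using poly_deg_Dn[OF assms, of "[h, h]"] by simp
  have "Dn (Dn f [h, h]) (replicate k h) x = Dn f (replicate k h @ [h, h]) x" for k
    by (simp add: Dn_append)
  then show ?thesis
    unfolding poly_deg_taylor[OF deg] Dn_replicate_scale[OF deg]
    using quartic_form_eq_Dn[OF assms, of h x]
    by (simp add: numeral_eq_Suc)
qed

lemma quartic_form_scale:
  assumes "poly_deg 4 f"
  shows "quartic_form f (c *\<^sub>R h) (c *\<^sub>R h) (c *\<^sub>R h) (c *\<^sub>R h) = c^4 * quartic_form f h h h h"
  using Dn_scale[OF assms, of c "[h, h, h, h]" 0]
  by (simp add: quartic_form_def power4_eq_xxxx mult.assoc del: Dn.simps)

text \<open>The fourth central difference annihilates cubics, so on a quartic it returns the leading form.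
  This transfers the continuity of \<open>f\<close> to \<open>h \<mapsto> quartic_form f h h h h\<close>.\<close>
lemma quartic_form_fourth_difference:
  assumes "poly_deg 4 f"
  shows "24 * quartic_form f h h h h
           = f (2 *\<^sub>R h) - 4 * f h + 6 * f 0 - 4 * f (- h) + f (- (2 *\<^sub>R h))"
  using quartic_taylor[OF assms, of 0 2 h] quartic_taylor[OF assms, of 0 1 h]
    quartic_taylor[OF assms, of 0 "-1" h] quartic_taylor[OF assms, of 0 "-2" h]
  by simp

section \<open>Quartic models of a convex quartic\<close>

text \<open>Averaging the expansions at \<open>x + s h\<close> and \<open>x - s h\<close> removes the odd terms; dividing by
  \<open>s\<^sup>2\<close> and letting \<open>s\<close> tend to \<open>0\<close> leaves the Hessian.\<close>
lemma convex_quartic_hessian_nonneg: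
  assumes "poly_deg 4 f" "convex_on UNIV f"
  shows "Dn f [h, h] x \<ge> 0"
proof -
  let ?q = "quartic_form f h h h h"
  have "Dn f [h, h] x + 2 * s^2 * ?q \<ge> 0" if "s \<noteq> 0" for s
  proof -
    have "f ((1 - 1/2) *\<^sub>R (x + (- s) *\<^sub>R h) + (1/2) *\<^sub>R (x + s *\<^sub>R h))
        \<le> (1 - 1/2) * f (x + (- s) *\<^sub>R h) + (1/2) * f (x + s *\<^sub>R h)"
      by (rule convex_onD[OF assms(2)]) auto
    moreover have "(1 - 1/2) *\<^sub>R (x + (- s) *\<^sub>R h) + (1/2) *\<^sub>R (x + s *\<^sub>R h) = x"
      by (simp add: algebra_simps flip: scaleR_add_left)
    ultimately have "2 * f x \<le> f (x + (- s) *\<^sub>R h) + f (x + s *\<^sub>R h)" by simp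
    also have "\<dots> = 2 * f x + s^2 * (Dn f [h, h] x + 2 * s^2 * ?q)"
      unfolding quartic_taylor[OF assms(1), of x _ h]
      by (simp add: algebra_simps power2_eq_square power4_eq_xxxx power3_eq_cube del: Dn.simps)
    finally have "s^2 * (Dn f [h, h] x + 2 * s^2 * ?q) \<ge> 0" by simp
    with that show ?thesis by (simp add: zero_le_mult_iff)
  qed
  then have "\<forall>\<^sub>F s in at 0. Dn f [h, h] x + 2 * s^2 * ?q \<ge> 0"
    by (auto simp: eventually_at_filter)
  moreover have "((\<lambda>s. Dn f [h, h] x + 2 * s^2 * ?q) \<longlongrightarrow> Dn f [h, h] x + 2 * 0^2 * ?q) (at 0)"
    by (intro tendsto_intros)
  ultimately show ?thesis
    using tendsto_lowerbound[of _ _ "at (0::real)" 0] by auto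
qed

text \<open>The Hessian is nonnegative not only at \<open>x\<close> but also at \<open>x + \<tau> h\<close> and \<open>x - \<tau> h\<close>. Its
  expansion there contains the third derivative with both signs, so the third derivative is
  dominated by the second and fourth ones. The parameter \<open>\<tau>\<close> balances the two.\<close>
lemma convex_quartic_third_derivative_bound:
  assumes "poly_deg 4 f" "convex_on UNIV f" "\<tau> > 0"
  shows "\<bar>Dn f [h, h, h] x\<bar> / 6 \<le> 1 / (6 * \<tau>) * Dn f [h, h] x + 2 * \<tau> * quartic_form f h h h h"
proof -
  have "\<tau> * \<bar>Dn f [h, h, h] x\<bar> \<le> Dn f [h, h] x + 12 * \<tau>^2 * quartic_form f h h h h"
    using convex_quartic_hessian_nonneg[OF assms(1,2), of h "x + \<tau> *\<^sub>R h"]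
      convex_quartic_hessian_nonneg[OF assms(1,2), of h "x + (- \<tau>) *\<^sub>R h"] \<open>\<tau> > 0\<close>
    unfolding quartic_hessian_taylor[OF assms(1)] by (auto simp: abs_if)
  with \<open>\<tau> > 0\<close> show ?thesis by (simp add: field_simps power2_eq_square)
qed

text \<open>Replacing the cubic Taylor term by its upper bound gives a model without third derivatives;
  this is the model minimized by the method. The lower model below uses the lower bound.\<close>
lemma convex_quartic_upper_model:
  assumes "poly_deg 4 f" "convex_on UNIV f" "\<tau> > 0"
  shows "f (x + h) \<le> f x + Dn f [h] x + (1 + 3 * \<tau>) / (6 * \<tau>) * Dn f [h, h] x
           + (1 + 2 * \<tau>) * quartic_form f h h h h"
proof -
  have coeff: "(1 + 3 * \<tau>) / (6 * \<tau>) = 1 / 2 + 1 / (6 * \<tau>)" using \<open>\<tau> > 0\<close> by (simp add: field_simps)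
  show ?thesis
    unfolding coeff
    using quartic_taylor[OF assms(1), of x 1 h] convex_quartic_third_derivative_bound[OF assms, of h x]
    by (simp add: ring_distribs abs_le_iff del: Dn.simps)
qed

lemma convex_quartic_lower_model:
  assumes "poly_deg 4 f" "convex_on UNIV f" "\<tau> > 0"
  shows "f x + Dn f [h] x + (3 * \<tau> - 1) / (6 * \<tau>) * Dn f [h, h] x
           + (1 - 2 * \<tau>) * quartic_form f h h h h \<le> f (x + h)"
proof -
  have coeff: "(3 * \<tau> - 1) / (6 * \<tau>) = 1 / 2 - 1 / (6 * \<tau>)" using \<open>\<tau> > 0\<close> by (simp add: field_simps)
  show ?thesis
    unfolding coeff
    using quartic_taylor[OF assms(1), of x 1 h] convex_quartic_third_derivative_bound[OF assms, of h x]
    by (simp add: ring_distribs abs_le_iff del: Dn.simps)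
qed

section \<open>Existence of a minimizer\<close>

text \<open>By homogeneity it suffices to bound the form below on the unit sphere, which is compact.\<close>
lemma quartic_form_lower_bound:
  fixes f :: "'a::euclidean_space \<Rightarrow> real"
  assumes "poly_deg 4 f" and pos: "\<And>h. h \<noteq> 0 \<Longrightarrow> quartic_form f h h h h > 0"
  obtains m where "m > 0" "\<And>h. m * norm h ^ 4 \<le> quartic_form f h h h h"
proof -
  let ?Q = "\<lambda>h. quartic_form f h h h h"
  have Q: "?Q = (\<lambda>h. (f (2 *\<^sub>R h) - 4 * f h + 6 * f 0 - 4 * f (- h) + f (- (2 *\<^sub>R h))) / 24)"
  proof
    show "?Q h = (f (2 *\<^sub>R h) - 4 * f h + 6 * f 0 - 4 * f (- h) + f (- (2 *\<^sub>R h))) / 24" for h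
      using quartic_form_fourth_difference[OF assms(1), of h] by simp
  qed
  have cont: "continuous_on (sphere 0 1) ?Q"
    unfolding Q
    by (intro continuous_intros continuous_on_compose2[OF poly_deg_continuous[OF assms(1), of UNIV]]) auto
  have nonempty: "sphere (0::'a) 1 \<noteq> {}" by simp
  obtain u where u: "u \<in> sphere 0 1" "\<And>v. v \<in> sphere 0 1 \<Longrightarrow> ?Q u \<le> ?Q v"
    using continuous_attains_inf[OF compact_sphere nonempty cont] by blast
  have "?Q u * norm h ^ 4 \<le> ?Q h" for h
  proof (cases "h = 0")
    case True
    then show ?thesis using quartic_form_scale[OF assms(1), of 0 h] by simp
  next
    case False
    then have "?Q u \<le> ?Q ((1 / norm h) *\<^sub>R h)" by (intro u) simp
    with False show ?thesis
      unfolding quartic_form_scale[OF assms(1)] by (simp add: field_simps)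
  qed
  moreover have "?Q u > 0" using u(1) by (intro pos) auto
  ultimately show ?thesis using that by blast
qed

text \<open>The quartic term outgrows any linear one. The tilt by \<open>a\<close> accounts for an affine minorant
  of \<open>\<psi>\<close>, which may decrease linearly.\<close>
lemma convex_quartic_tilted_sublevel_bounded:
  fixes f :: "'a::euclidean_space \<Rightarrow> real"
  assumes "poly_deg 4 f" "convex_on UNIV f"
    and "\<And>h. h \<noteq> 0 \<Longrightarrow> quartic_form f h h h h > 0"
  shows "bounded {y. f y + a \<bullet> y \<le> v}"
proof -
  obtain m where m: "m > 0" "\<And>h. m * norm h ^ 4 \<le> quartic_form f h h h h"
    using quartic_form_lower_bound[OF assms(1,3)] by blast
  have "bounded_linear (\<lambda>y. Dn f [y] 0 + a \<bullet> y)"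
  proof (rule bounded_linear_add)
    have "Dn f [] = f" by auto
    then show "bounded_linear (\<lambda>y. Dn f [y] 0)"
      using poly_deg_differentiable[OF assms(1), of 0, unfolded frechet_derivative_works]
      by (simp add: has_derivative_def)
  qed (rule bounded_linear_inner_right)
  then obtain K where K: "\<And>y. norm (Dn f [y] 0 + a \<bullet> y) \<le> norm y * K"
    using bounded_linear.bounded by blast
  define R where "R = 3 * (\<bar>v - f 0\<bar> + K) / m"
  have "norm y \<le> max 1 R" if y: "f y + a \<bullet> y \<le> v" for y
  proof (cases "norm y \<ge> 1")
    case True
    \<comment> \<open>The value \<open>1/3\<close> makes the Hessian term of the lower model vanish.\<close>
    have "f 0 + Dn f [y] 0 + quartic_form f y y y y / 3 \<le> f y"
      using convex_quartic_lower_model[OF assms(1,2), of "1/3" 0 y] by simp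
    moreover have "- (Dn f [y] 0 + a \<bullet> y) \<le> norm y * K"
      using K[of y] by (simp add: abs_le_iff del: Dn.simps)
    ultimately have "quartic_form f y y y y / 3 \<le> \<bar>v - f 0\<bar> + norm y * K"
      using y by (simp add: abs_if del: Dn.simps)
    then have "m * norm y ^ 4 \<le> 3 * (\<bar>v - f 0\<bar> + norm y * K)"
      using m(2)[of y] by simp
    also have "\<dots> \<le> 3 * (\<bar>v - f 0\<bar> * norm y + norm y * K)"
      using mult_left_mono[OF True, of "\<bar>v - f 0\<bar>"] by simp
    also have "\<dots> = (3 * (\<bar>v - f 0\<bar> + K)) * norm y" by (simp add: algebra_simps)
    finally have "m * norm y ^ 4 \<le> (3 * (\<bar>v - f 0\<bar> + K)) * norm y" .
    moreover have "m * norm y ^ 2 \<le> m * norm y ^ 4"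
      using True m(1) by (simp add: power_increasing)
    ultimately have "(m * norm y) * norm y \<le> (3 * (\<bar>v - f 0\<bar> + K)) * norm y"
      by (simp add: power2_eq_square)
    then have "m * norm y \<le> 3 * (\<bar>v - f 0\<bar> + K)"
      by (rule mult_right_le_imp_le) (use True in linarith)
    then have "norm y \<le> R" using m(1) by (simp add: R_def field_simps)
    then show ?thesis by simp
  qed simp
  then show ?thesis unfolding bounded_iff by blast
qed

text \<open>A hyperplane separating the closed convex epigraph from a point just below it is the graph of
  an affine minorant.\<close>
lemma closed_convex_fun_affine_minorant:
  fixes \<psi> :: "'a::euclidean_space \<Rightarrow> real"
  assumes "closed_convex_fun D \<psi>"
  obtains a c where "\<And>y. y \<in> D \<Longrightarrow> a \<bullet> y + c \<le> \<psi> y"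
proof -
  have "convex (epigraph D \<psi>)" "closed (epigraph D \<psi>)"
    using assms by (auto simp: closed_convex_fun_def convex_epigraph)
  obtain z where z: "z \<in> D" using assms by (auto simp: closed_convex_fun_def)
  have "(z, \<psi> z - 1) \<notin> epigraph D \<psi>" by (simp add: mem_epigraph)
  then obtain n b where nb: "n \<bullet> (z, \<psi> z - 1) < b" "\<And>p. p \<in> epigraph D \<psi> \<Longrightarrow> b < n \<bullet> p"
    using separating_hyperplane_closed_point[OF \<open>convex (epigraph D \<psi>)\<close> \<open>closed (epigraph D \<psi>)\<close>]
    by blast
  obtain g \<beta> where n: "n = (g, \<beta>)" by (cases n)
  have above: "b < g \<bullet> y + \<beta> * \<psi> y" if "y \<in> D" for y
    using nb(2)[of "(y, \<psi> y)"] that by (simp add: n mem_epigraph)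
  \<comment> \<open>The separated points differ only in the last coordinate, so the hyperplane is not vertical.\<close>
  have "\<beta> > 0" using nb(1) above[OF z] by (simp add: n algebra_simps)
  have "((- 1 / \<beta>) *\<^sub>R g) \<bullet> y + b / \<beta> \<le> \<psi> y" if "y \<in> D" for y
    using above[OF that] \<open>\<beta> > 0\<close> by (simp add: field_simps)
  then show ?thesis using that by blast
qed

text \<open>The domain \<open>D\<close> can be open and \<open>\<psi>\<close> discontinuous at its boundary, so the
  compactness argument takes place in the epigraph: there the objective becomes the continuous
  function \<open>(y, r) \<mapsto> f y + r\<close>, and the part of the epigraph on which it does not exceed a value
  \<open>v\<close> is closed and, by coercivity and an affine minorant of \<open>\<psi>\<close>, bounded.\<close>
lemma composite_attains_minimum:
  fixes f \<psi> :: "'a::euclidean_space \<Rightarrow> real"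
  assumes closed_convex: "closed_convex_fun D \<psi>" and cont: "continuous_on UNIV f"
    and coercive: "\<And>a v. bounded {y. f y + a \<bullet> y \<le> v}"
  obtains y where "y \<in> D" "\<And>z. z \<in> D \<Longrightarrow> f y + \<psi> y \<le> f z + \<psi> z"
proof -
  obtain a c where minorant: "\<And>y. y \<in> D \<Longrightarrow> a \<bullet> y + c \<le> \<psi> y"
    using closed_convex_fun_affine_minorant[OF closed_convex] by blast
  obtain x0 where x0: "x0 \<in> D" using closed_convex by (auto simp: closed_convex_fun_def)
  define v where "v = f x0 + \<psi> x0"
  define E where "E = epigraph D \<psi> \<inter> {p. f (fst p) + snd p \<le> v}"
  have cont': "continuous_on UNIV (\<lambda>p::'a \<times> real. f (fst p) + snd p)"
    by (intro continuous_intros continuous_on_compose2[OF cont]) auto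
  have "closed E"
    unfolding E_def
    using closed_convex cont'
    by (intro closed_Int closed_Collect_le) (auto simp: closed_convex_fun_def)
  define B where "B = closure {y. f y + a \<bullet> y \<le> v - c}"
  have "compact B" using coercive by (simp add: B_def)
  then have "bounded ((\<lambda>y. v - f y) ` B)" "bounded ((\<lambda>y. a \<bullet> y + c) ` B)"
    by (intro compact_imp_bounded compact_continuous_image continuous_intros
        continuous_on_subset[OF cont]; simp)+
  then obtain M N where MN: "\<And>y. y \<in> B \<Longrightarrow> \<bar>v - f y\<bar> \<le> M" "\<And>y. y \<in> B \<Longrightarrow> \<bar>a \<bullet> y + c\<bar> \<le> N"
    unfolding bounded_iff by auto
  have "E \<subseteq> B \<times> {- N..M}"
  proof
    fix p assume "p \<in> E"
    then obtain y r where p: "p = (y, r)" "y \<in> D" "\<psi> y \<le> r" "f y + r \<le> v"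
      by (cases p) (auto simp: E_def mem_epigraph)
    with minorant[of y] have "y \<in> B" unfolding B_def by (intro closure_subset[THEN subsetD]) simp
    with p minorant[of y] MN[of y] show "p \<in> B \<times> {- N..M}" by auto
  qed
  then have "bounded E"
    by (rule bounded_subset[rotated])
       (intro bounded_Times compact_imp_bounded \<open>compact B\<close> bounded_closed_interval)
  with \<open>closed E\<close> have "compact E" by (simp add: compact_eq_bounded_closed)
  have x0E: "(x0, \<psi> x0) \<in> E" using x0 by (simp add: E_def v_def mem_epigraph)
  then obtain p where p: "p \<in> E" "\<And>q. q \<in> E \<Longrightarrow> f (fst p) + snd p \<le> f (fst q) + snd q"
    using continuous_attains_inf[OF \<open>compact E\<close> _ continuous_on_subset[OF cont']] by blast
  have "f (fst p) + \<psi> (fst p) \<le> f z + \<psi> z" if "z \<in> D" for z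
  proof (cases "f z + \<psi> z \<le> v")
    case True
    then have "(z, \<psi> z) \<in> E" using that by (simp add: E_def mem_epigraph)
    from p(2)[OF this] p(1) show ?thesis by (simp add: E_def epigraph_def)
  next
    case False
    with p(1) show ?thesis by (simp add: E_def epigraph_def)
  qed
  moreover have "fst p \<in> D" using p(1) by (simp add: E_def epigraph_def)
  ultimately show ?thesis using that by blast
qed

lemma min_value_attained:
  assumes "y \<in> D" "\<And>z. z \<in> D \<Longrightarrow> F y \<le> F z"
  shows "min_value F D = F y"
  unfolding min_value_def using assms by (intro Least_equality) auto

section \<open>The constants of the method\<close>

lemma eq_root_3_iff: "x = root 3 y \<longleftrightarrow> x ^ 3 = y" for x y :: real
  using odd_real_root_pow[of 3 y] odd_real_root_power_cancel[of 3 x] by auto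

text \<open>After clearing denominators the odd powers of \<open>\<tau>\<close> cancel, and a quadratic equation for
  \<open>\<tau>\<^sup>2\<close> with exactly one positive root remains.\<close>
lemma damped_step_cubic_iff:
  fixes \<tau> :: real
  assumes "\<tau> > 0"
  shows "((3 * \<tau> - 1) / (3 * \<tau> + 1)) ^ 3 = (1 - 2 * \<tau>) / (1 + 2 * \<tau>)
           \<longleftrightarrow> \<tau> = 1/6 * sqrt (3 + sqrt 33)"
proof -
  have "((3 * \<tau> - 1) / (3 * \<tau> + 1)) ^ 3 = (1 - 2 * \<tau>) / (1 + 2 * \<tau>)
      \<longleftrightarrow> (3 * \<tau> - 1) ^ 3 * (1 + 2 * \<tau>) = (1 - 2 * \<tau>) * (3 * \<tau> + 1) ^ 3"
    using assms by (subst power_divide, subst frac_eq_eq) auto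
  also have "\<dots> \<longleftrightarrow> (36 * \<tau>^2 - 3)^2 = 33"
  proof -
    have "(36 * \<tau>^2 - 3)^2 - 33
        = 12 * ((3 * \<tau> - 1) ^ 3 * (1 + 2 * \<tau>) - (1 - 2 * \<tau>) * (3 * \<tau> + 1) ^ 3)"
      by (simp add: power2_eq_square power3_eq_cube algebra_simps)
    then have "(36 * \<tau>^2 - 3)^2 - 33 = 0
        \<longleftrightarrow> (3 * \<tau> - 1) ^ 3 * (1 + 2 * \<tau>) - (1 - 2 * \<tau>) * (3 * \<tau> + 1) ^ 3 = 0"
      by simp
    then show ?thesis by (simp only: right_minus_eq)
  qed
  also have "\<dots> \<longleftrightarrow> 36 * \<tau>^2 = 3 + sqrt 33"
  proof
    assume sq: "(36 * \<tau>^2 - 3)^2 = 33"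
    have "36 * \<tau>^2 - 3 \<ge> 0"
    proof (rule ccontr)
      assume "\<not> ?thesis"
      then have "\<bar>36 * \<tau>^2 - 3\<bar> \<le> 3" by auto
      then have "(36 * \<tau>^2 - 3)^2 \<le> 3^2" by (rule power2_le_iff_abs_le[THEN iffD2, rotated]) simp
      with sq show False by simp
    qed
    with sq have "sqrt 33 = 36 * \<tau>^2 - 3" by (metis real_sqrt_unique)
    then show "36 * \<tau>^2 = 3 + sqrt 33" by simp
  qed simp
  also have "\<dots> \<longleftrightarrow> (6 * \<tau>)^2 = 3 + sqrt 33" by (simp add: power_mult_distrib)
  also have "\<dots> \<longleftrightarrow> 6 * \<tau> = sqrt (3 + sqrt 33)"
  proof
    assume "(6 * \<tau>)^2 = 3 + sqrt 33"
    from real_sqrt_unique[OF this] assms show "6 * \<tau> = sqrt (3 + sqrt 33)" by simp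
  next
    assume "6 * \<tau> = sqrt (3 + sqrt 33)"
    then show "(6 * \<tau>)^2 = 3 + sqrt 33" by (simp only: real_sqrt_pow2) simp
  qed
  finally show ?thesis by auto
qed

lemma tau_star_eq: "tau_star = 1/6 * sqrt (3 + sqrt 33)"
proof -
  define c :: real where "c = 1/6 * sqrt (3 + sqrt 33)"
  have "c > 0" by (simp add: c_def add_pos_nonneg)
  have unique: "\<tau> > 0 \<and> (3 * \<tau> - 1) / (3 * \<tau> + 1) = root 3 ((1 - 2 * \<tau>) / (1 + 2 * \<tau>)) \<longleftrightarrow> \<tau> = c" for \<tau>
  proof (cases "\<tau> > 0")
    case True
    then show ?thesis
      unfolding eq_root_3_iff damped_step_cubic_iff[OF True] c_def by simp
  next
    case False
    with \<open>c > 0\<close> show ?thesis by auto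
  qed
  show ?thesis unfolding tau_star_def unique the_eq_trivial by (rule c_def)
qed

lemma tau_star_pos: "tau_star > 0"
  by (simp add: tau_star_eq add_pos_nonneg)

lemma alpha_star_cubed: "alpha_star ^ 3 = (1 - 2 * tau_star) / (1 + 2 * tau_star)"
  unfolding alpha_star_def using damped_step_cubic_iff[OF tau_star_pos] tau_star_eq by blast

lemma alpha_star_gt: "alpha_star > 0.193"
proof -
  \<comment> \<open>Since \<open>193 / 1000 < alpha_star\<close> amounts to \<open>3 * tau_star > 1193 / 807\<close>, about 1.47831, it is
    enough to know \<open>sqrt (3 + sqrt 33)\<close>, which is twice the left-hand side, to three decimals.\<close>
  have "5.7445 < sqrt 33" by (rule real_less_rsqrt) (simp add: power2_eq_square)
  then have "2.957 < sqrt (3 + sqrt 33)"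
    by (intro real_less_rsqrt) (simp add: power2_eq_square)
  then have "2 * tau_star > 2.957 / 3" by (simp add: tau_star_eq)
  then show ?thesis using tau_star_pos by (simp add: alpha_star_def field_simps)
qed

lemma alpha_star_less_1: "alpha_star < 1"
  using tau_star_pos by (simp add: alpha_star_def field_simps)

section \<open>Linear convergence\<close>

lemma fnorm_power4:
  assumes "\<And>h. h \<noteq> 0 \<Longrightarrow> quartic_form f h h h h > 0" "poly_deg 4 f"
  shows "fnorm f h ^ 4 = quartic_form f h h h h"
proof -
  have "quartic_form f h h h h \<ge> 0"
    using assms(1)[of h] quartic_form_scale[OF assms(2), of 0 0] by (cases "h = 0") auto
  then show ?thesis by (simp add: fnorm_def)
qed

lemma fhat_upper:
  assumes "poly_deg 4 f" "convex_on UNIV f"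
    and "\<And>h. h \<noteq> 0 \<Longrightarrow> quartic_form f h h h h > 0" and "\<tau> > 0"
  shows "f y \<le> fhat f x \<tau> y"
  using convex_quartic_upper_model[OF assms(1,2,4), of x "y - x"]
  by (simp add: fhat_def fnorm_power4[OF assms(3,1)] del: Dn.simps)

text \<open>This is where \<open>tau_star\<close> comes from. At the point \<open>x + \<alpha> (y - x)\<close> the second and fourth
  order terms of the upper model carry the factors \<open>\<alpha>\<^sup>2\<close> and \<open>\<alpha>\<^sup>4\<close>. The definition of
  \<open>alpha_star\<close> turns the second order term into \<open>\<alpha>\<close> times that of the lower model at \<open>y\<close>, and the
  equation for \<open>tau_star\<close> does the same with the fourth order term. Hence the upper model at
  this point is a convex combination of \<open>f x\<close> and the lower model at \<open>y\<close>.\<close>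
lemma fhat_damped_point:
  assumes deg: "poly_deg 4 f" and conv: "convex_on UNIV f"
    and pos: "\<And>h. h \<noteq> 0 \<Longrightarrow> quartic_form f h h h h > 0"
  shows "fhat f x tau_star ((1 - alpha_star) *\<^sub>R x + alpha_star *\<^sub>R y)
           \<le> (1 - alpha_star) * f x + alpha_star * f y"
proof -
  define h where "h = y - x"
  let ?\<tau> = tau_star and ?\<alpha> = alpha_star
  let ?H = "Dn f [h, h] x" and ?Q = "quartic_form f h h h h"
  have point: "(1 - ?\<alpha>) *\<^sub>R x + ?\<alpha> *\<^sub>R y - x = ?\<alpha> *\<^sub>R h"
    by (simp add: h_def algebra_simps)
  have hess: "(1 + 3 * ?\<tau>) / (6 * ?\<tau>) * (?\<alpha>^2 * ?H) = ?\<alpha> * ((3 * ?\<tau> - 1) / (6 * ?\<tau>) * ?H)"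
  proof -
    have "3 * ?\<tau> - 1 = (1 + 3 * ?\<tau>) * ?\<alpha>"
      using tau_star_pos by (simp add: alpha_star_def add.commute)
    then show ?thesis by (simp add: power2_eq_square del: Dn.simps)
  qed
  have quart: "(1 + 2 * ?\<tau>) * (?\<alpha>^4 * ?Q) = ?\<alpha> * ((1 - 2 * ?\<tau>) * ?Q)"
  proof -
    have cubed: "1 - 2 * ?\<tau> = (1 + 2 * ?\<tau>) * ?\<alpha>^3"
      using tau_star_pos by (simp add: alpha_star_cubed)
    show ?thesis unfolding cubed by (simp add: power3_eq_cube power4_eq_xxxx del: Dn.simps)
  qed
  have "fhat f x ?\<tau> ((1 - ?\<alpha>) *\<^sub>R x + ?\<alpha> *\<^sub>R y)
      = f x + ?\<alpha> * Dn f [h] x + (1 + 3 * ?\<tau>) / (6 * ?\<tau>) * (?\<alpha>^2 * ?H) + (1 + 2 * ?\<tau>) * (?\<alpha>^4 * ?Q)"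
    unfolding fhat_def point
    using Dn_scale[OF deg, of ?\<alpha> "[h]" x] Dn_scale[OF deg, of ?\<alpha> "[h, h]" x]
    by (simp add: fnorm_power4[OF pos deg] quartic_form_scale[OF deg] power2_eq_square del: Dn.simps)
  also have "\<dots> = f x + ?\<alpha> * (Dn f [h] x + (3 * ?\<tau> - 1) / (6 * ?\<tau>) * ?H + (1 - 2 * ?\<tau>) * ?Q)"
    unfolding hess quart by (simp add: distrib_left del: Dn.simps)
  also have "\<dots> \<le> f x + ?\<alpha> * (f y - f x)"
    using convex_quartic_lower_model[OF deg conv tau_star_pos, of x h] alpha_star_gt
    by (intro add_left_mono mult_left_mono) (auto simp: h_def simp del: Dn.simps)
  finally show ?thesis by (simp add: algebra_simps)
qed

text \<open>The new point is at least as good for the upper model as the damped point on the segment from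
  \<open>x\<close> to \<open>y\<close>, and there \<open>\<psi>\<close> lies below its own chord and the model below the chord of \<open>f\<close>. Taking a minimizer of the
  objective for \<open>y\<close> contracts the gap to the minimal value by the factor \<open>1 - alpha_star\<close>.\<close>
lemma damped_newton_step:
  assumes deg: "poly_deg 4 f" and conv: "convex_on UNIV f"
    and pos: "\<And>h. h \<noteq> 0 \<Longrightarrow> quartic_form f h h h h > 0"
    and \<psi>: "convex_on D \<psi>"
    and step: "is_arg_min (\<lambda>y. fhat f x tau_star y + \<psi> y) (\<lambda>y. y \<in> D) x'"
    and "x \<in> D" "y \<in> D"
  shows "f x' + \<psi> x' \<le> (1 - alpha_star) * (f x + \<psi> x) + alpha_star * (f y + \<psi> y)"
proof -
  let ?z = "(1 - alpha_star) *\<^sub>R x + alpha_star *\<^sub>R y"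
  have \<alpha>: "0 \<le> alpha_star" "alpha_star \<le> 1"
    using alpha_star_gt alpha_star_less_1 by auto
  have "?z \<in> D"
    using convex_on_imp_convex[OF \<psi>] \<alpha> \<open>x \<in> D\<close> \<open>y \<in> D\<close> by (simp add: convex_def)
  have "f x' + \<psi> x' \<le> fhat f x tau_star x' + \<psi> x'"
    using fhat_upper[OF deg conv pos tau_star_pos] by simp
  also have "\<dots> \<le> fhat f x tau_star ?z + \<psi> ?z"
    using step \<open>?z \<in> D\<close> by (simp add: is_arg_min_linorder)
  also have "\<dots> \<le> ((1 - alpha_star) * f x + alpha_star * f y) + ((1 - alpha_star) * \<psi> x + alpha_star * \<psi> y)"
    using fhat_damped_point[OF deg conv pos] convex_onD[OF \<psi> \<alpha> \<open>x \<in> D\<close> \<open>y \<in> D\<close>]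
    by (intro add_mono)
  finally show ?thesis by (simp add: algebra_simps)
qed

theorem theorem3:
  fixes f \<psi> F :: "'a::euclidean_space \<Rightarrow> real"
    and D :: "'a set"
    and x :: "nat \<Rightarrow> 'a"
    and F_star :: real
  assumes "poly_fun_of_degree 4 f"
    and "convex_on UNIV f"
    and "\<And>h. h \<noteq> 0 \<Longrightarrow> quartic_form f h h h h > 0"
    and "closed_convex_fun D \<psi>"
    and "damped_quartic_newton f D \<psi> x"
  defines "F \<equiv> \<lambda>y. f y + \<psi> y"
    and "F_star \<equiv> min_value F D"
  shows "(\<forall>k. F (x k) - F_star \<le> (1 - alpha_star) ^ k * (F (x 0) - F_star))
    \<and> alpha_star > 0.193
    \<and> tau_star = 1/6 * sqrt (3 + sqrt 33)"
proof (intro conjI allI)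
  have deg: "poly_deg 4 f"
    using assms(1) poly_fun_le_imp_poly_deg by (auto simp: poly_fun_of_degree_def)
  obtain y where y: "y \<in> D" "\<And>z. z \<in> D \<Longrightarrow> f y + \<psi> y \<le> f z + \<psi> z"
    using composite_attains_minimum[OF assms(4) poly_deg_continuous[OF deg]
        convex_quartic_tilted_sublevel_bounded[OF deg assms(2,3)]] by blast
  then have F_star: "F_star = f y + \<psi> y"
    unfolding F_star_def F_def by (intro min_value_attained)
  have iter: "x k \<in> D" for k
    using assms(5) by (cases k) (auto simp: damped_quartic_newton_def is_arg_min_def)
  have \<psi>: "convex_on D \<psi>" using assms(4) by (simp add: closed_convex_fun_def)
  show "F (x k) - F_star \<le> (1 - alpha_star) ^ k * (F (x 0) - F_star)" for k
  proof (induction k)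
    case (Suc k)
    have "is_arg_min (\<lambda>y. fhat f (x k) tau_star y + \<psi> y) (\<lambda>y. y \<in> D) (x (Suc k))"
      using assms(5) by (simp add: damped_quartic_newton_def)
    from damped_newton_step[OF deg assms(2,3) \<psi> this iter y(1)]
    have "F (x (Suc k)) - F_star \<le> (1 - alpha_star) * (F (x k) - F_star)"
      by (simp add: F_def F_star algebra_simps)
    also have "\<dots> \<le> (1 - alpha_star) * ((1 - alpha_star) ^ k * (F (x 0) - F_star))"
      using Suc alpha_star_less_1 by (intro mult_left_mono) auto
    finally show ?case by simp
  qed simp
qed (rule alpha_star_gt tau_star_eq)+

end
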